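(* Let $\Gamma=\Gamma_1\oplus\Gamma_2$ with $\Gamma_1=\mathbb Z_{2^{n_1}}\oplus\cdots\oplus\mathbb Z_{2^{n_r}}$, $\Gamma_2=\mathbb Z_{p_1^{m_1}}\oplus\cdots\oplus\mathbb Z_{p_s^{m_s}}$, all $p_i>2$ prime, and $\mathbf m_\Gamma=(2^{n_1},\dots,2^{n_r},p_1^{m_1},\dots,p_s^{m_s})$. Suppose $\mathbf D_1\in\mathscr D$, $\mathbf D_2\in\tilde{\mathscr D}$ and $\mathbf D_1\cap\mathbf D_2=\emptyset$. If $\mathbf D=\mathbf D_1\cup\mathbf D_2$ is such that $S_\Gamma(\mathbf D)$ generates $\Gamma$, then $Cay(\Gamma,S_\Gamma(\mathbf D))$ is connected and admits perfect state transfer at time $\frac{\pi}{2}$.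
   Context: Transition matrix of a graph with adjacency matrix $A$ (loops contribute $1$ on the diagonal): $H(t)=\exp(itA)$. The graph admits perfect state transfer (PST) at $\tau$ if there are distinct vertices $u,v$ with $|H(\tau)_{uv}|=1$. $Cay(\Gamma,S)$: vertex set $\Gamma$, $a\sim b$ iff $a-b\in S$. Gcd-sets: represent components $x_i\in\mathbb Z_{m_i}$ by integers in $\{0,\dots,m_i-1\}$, with $\gcd(0,n)=n$; for a divisor tuple $\mathbf d$ of $\mathbf m_\Gamma$, $S_\Gamma(\mathbf d)=\{\mathbf x\in\Gamma:\gcd(x_i,(\mathbf m_\Gamma)_i)=d_i\ \forall i\}$, and $S_\Gamma(\mathbf D)=\bigcup_{\mathbf d\in\mathbf D}S_\Gamma(\mathbf d)$. Associated binary set: for $\mathbf d\in\mathbf D$ and $i\le r$ write $d_i=2^{k_i}$ and let $\mathbf C_{d_i}=\{(c_0,\dots,c_{n_i-1})\in\mathbb Z_2^{n_i}: c_j=0\ (j<k_i),\ c_{k_i}=1\}$ if $k_i<n_i$, $\mathbf C_{d_i}=\{\mathbf 0\}$ if $k_i=n_i$; $\mathbf C(\mathbf D)=\bigcup_{\mathbf d\in\mathbf D}\mathbf C_{d_1}\times\cdots\times\mathbf C_{d_r}\subseteq\mathbb Z_2^{n_1+\cdots+n_r}$. $\mathscr D'$ is the collection of sets $\mathbf D$ of divisor tuples of $\mathbf m_\Gamma$ with $\mathbf m_\Gamma\notin\mathbf D$, all tuples sharing the same last $s$ components $d_{r+1},\dots,d_{r+s}$, the sum of the elements of $\mathbf C(\mathbf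 D)$ equal to $\mathbf 0$, and $|\mathbf C(\mathbf D)|\equiv0\pmod4$ whenever $d_{r+i}<p_i^{m_i}$ for some $i$; $\mathscr D$ is the collection of disjoint unions of members of $\mathscr D'$. $\tilde{\mathscr D}$ is the collection of sets $\mathbf D$ of divisor tuples of $\mathbf m_\Gamma$ with $\mathbf m_\Gamma\notin\mathbf D$, every tuple having last $s$ components $d_{r+j}=p_j^{m_j}$ ($j=1,\dots,s$), and the sum of the elements of $\mathbf C(\mathbf D)$ nonzero. *)

theory Defs
  imports
    Complex_Main
    "HOL-Library.Z2"
    "HOL-Library.Disjoint_Sets"
    "HOL-Computational_Algebra.Primes"
    "HOL-Algebra.Generated_Groups"
    "HOL-Algebra.Product_Groups"
    "Graph_Theory.Digraph_Component"
begin

text \<open>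
  Matrices whose rows and columns are indexed by a finite set \<open>V\<close> are functions
  \<open>'v \<Rightarrow> 'v \<Rightarrow> complex\<close>; only the entries on \<open>V\<close> matter.
\<close>

primrec matrix_power :: "'v set \<Rightarrow> ('v \<Rightarrow> 'v \<Rightarrow> complex) \<Rightarrow> nat \<Rightarrow> 'v \<Rightarrow> 'v \<Rightarrow> complex" where
  "matrix_power V A 0 = (\<lambda>u v. if u = v then 1 else 0)"
| "matrix_power V A (Suc k) = (\<lambda>u v. \<Sum>w\<in>V. A u w * matrix_power V A k w v)"

definition matrix_exp :: "'v set \<Rightarrow> ('v \<Rightarrow> 'v \<Rightarrow> complex) \<Rightarrow> 'v \<Rightarrow> 'v \<Rightarrow> complex" where
  "matrix_exp V A u v = (\<Sum>k. matrix_power V A k u v / fact k)"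

definition adjacency_matrix :: "'v pair_pre_digraph \<Rightarrow> 'v \<Rightarrow> 'v \<Rightarrow> complex" where
  "adjacency_matrix X u v = (if (u, v) \<in> parcs X then 1 else 0)"

definition transition_matrix :: "'v pair_pre_digraph \<Rightarrow> real \<Rightarrow> 'v \<Rightarrow> 'v \<Rightarrow> complex" where
  "transition_matrix X t =
     matrix_exp (pverts X) (\<lambda>u v. \<i> * complex_of_real t * adjacency_matrix X u v)"

definition admits_PST :: "'v pair_pre_digraph \<Rightarrow> real \<Rightarrow> bool" where
  "admits_PST X \<tau> \<longleftrightarrow>
     (\<exists>u\<in>pverts X. \<exists>v\<in>pverts X. u \<noteq> v \<and> cmod (transition_matrix X \<tau> u v) = 1)"

text \<open>
  Groups of \<^theory>\<open>HOL-Algebra.Group\<close> are written multiplicatively, so \<open>a - b\<close> becomes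
  \<open>a \<otimes> inv b\<close>. An undirected graph is a set of vertices with a symmetric set of arcs.
\<close>

definition Cay :: "('a, 'b) monoid_scheme \<Rightarrow> 'a set \<Rightarrow> 'a pair_pre_digraph" where
  "Cay G S =
     \<lparr>pverts = carrier G,
      parcs = {(a, b). a \<in> carrier G \<and> b \<in> carrier G \<and> a \<otimes>\<^bsub>G\<^esub> inv\<^bsub>G\<^esub> b \<in> S}\<rparr>"

text \<open>
  All indices start at \<open>0\<close>: positions \<open>0, \<dots>, r - 1\<close> of a tuple belong to the 2-part and
  positions \<open>r, \<dots>, r + s - 1\<close> to the odd part. Tuples are extensional functions, as in
  \<^const>\<open>product_group\<close>.
\<close>

definition modulus_tuple ::
    "nat \<Rightarrow> nat \<Rightarrow> (nat \<Rightarrow> nat) \<Rightarrow> (nat \<Rightarrow> nat) \<Rightarrow> (nat \<Rightarrow> nat) \<Rightarrow> nat \<Rightarrow> nat" where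
  "modulus_tuple r s n p m =
     (\<lambda>i\<in>{..<r + s}. if i < r then 2 ^ n i else p (i - r) ^ m (i - r))"

definition Gam ::
    "nat \<Rightarrow> nat \<Rightarrow> (nat \<Rightarrow> nat) \<Rightarrow> (nat \<Rightarrow> nat) \<Rightarrow> (nat \<Rightarrow> nat) \<Rightarrow> (nat \<Rightarrow> int) monoid" where
  "Gam r s n p m =
     product_group {..<r + s} (\<lambda>i. integer_mod_group (modulus_tuple r s n p m i))"

definition divisor_tuples ::
    "nat \<Rightarrow> nat \<Rightarrow> (nat \<Rightarrow> nat) \<Rightarrow> (nat \<Rightarrow> nat) \<Rightarrow> (nat \<Rightarrow> nat) \<Rightarrow> (nat \<Rightarrow> nat) set" where
  "divisor_tuples r s n p m =
     (\<Pi>\<^sub>E i\<in>{..<r + s}. {d. d dvd modulus_tuple r s n p m i})"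

definition gcd_set ::
    "nat \<Rightarrow> nat \<Rightarrow> (nat \<Rightarrow> nat) \<Rightarrow> (nat \<Rightarrow> nat) \<Rightarrow> (nat \<Rightarrow> nat) \<Rightarrow> (nat \<Rightarrow> nat) set
       \<Rightarrow> (nat \<Rightarrow> int) set" where
  "gcd_set r s n p m D =
     (\<Union>d\<in>D. {x \<in> carrier (Gam r s n p m).
        \<forall>i<r + s. gcd (x i) (int (modulus_tuple r s n p m i)) = int (d i)})"

text \<open>The set \<open>\<^bold>C\<^sub>d\<close> for a divisor \<open>d = 2 ^ k\<close> of \<open>2 ^ N\<close>.\<close>

definition binary_block :: "nat \<Rightarrow> nat \<Rightarrow> (nat \<Rightarrow> bit) set" where
  "binary_block N d =
     (let k = multiplicity 2 d in
      if k < N then {c \<in> {..<N} \<rightarrow>\<^sub>E UNIV. (\<forall>j<k. c j = 0) \<and> c k = 1}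
      else {\<lambda>j\<in>{..<N}. 0})"

text \<open>
  A vector in \<open>\<int>\<^sub>2\<close> to the power \<open>n\<^sub>0 + \<dots> + n\<^sub>r\<^sub>-\<^sub>1\<close> is kept in blocks: \<open>c i j\<close> is coordinate
  \<open>j < n i\<close> of block \<open>i < r\<close>.
\<close>

definition binary_set ::
    "nat \<Rightarrow> (nat \<Rightarrow> nat) \<Rightarrow> (nat \<Rightarrow> nat) set \<Rightarrow> (nat \<Rightarrow> nat \<Rightarrow> bit) set" where
  "binary_set r n D = (\<Union>d\<in>D. \<Pi>\<^sub>E i\<in>{..<r}. binary_block (n i) (d i))"

definition zero_sum :: "nat \<Rightarrow> (nat \<Rightarrow> nat) \<Rightarrow> (nat \<Rightarrow> nat \<Rightarrow> bit) set \<Rightarrow> bool" where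
  "zero_sum r n C \<longleftrightarrow> (\<forall>i<r. \<forall>j<n i. (\<Sum>c\<in>C. c i j) = 0)"

definition script_D' ::
    "nat \<Rightarrow> nat \<Rightarrow> (nat \<Rightarrow> nat) \<Rightarrow> (nat \<Rightarrow> nat) \<Rightarrow> (nat \<Rightarrow> nat) \<Rightarrow> (nat \<Rightarrow> nat) set set" where
  "script_D' r s n p m =
     {D. D \<subseteq> divisor_tuples r s n p m \<and>
         modulus_tuple r s n p m \<notin> D \<and>
         (\<forall>d\<in>D. \<forall>e\<in>D. \<forall>j<s. d (r + j) = e (r + j)) \<and>
         zero_sum r n (binary_set r n D) \<and>
         ((\<exists>d\<in>D. \<exists>j<s. d (r + j) < p j ^ m j) \<longrightarrow> card (binary_set r n D) mod 4 = 0)}"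

definition script_D ::
    "nat \<Rightarrow> nat \<Rightarrow> (nat \<Rightarrow> nat) \<Rightarrow> (nat \<Rightarrow> nat) \<Rightarrow> (nat \<Rightarrow> nat) \<Rightarrow> (nat \<Rightarrow> nat) set set" where
  "script_D r s n p m = {\<Union>F | F. F \<subseteq> script_D' r s n p m \<and> disjoint F}"

definition script_D_tilde ::
    "nat \<Rightarrow> nat \<Rightarrow> (nat \<Rightarrow> nat) \<Rightarrow> (nat \<Rightarrow> nat) \<Rightarrow> (nat \<Rightarrow> nat) \<Rightarrow> (nat \<Rightarrow> nat) set set" where
  "script_D_tilde r s n p m =
     {D. D \<subseteq> divisor_tuples r s n p m \<and>
         modulus_tuple r s n p m \<notin> D \<and>
         (\<forall>d\<in>D. \<forall>j<s. d (r + j) = p j ^ m j) \<and>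
         \<not> zero_sum r n (binary_set r n D)}"

end

theory Submission
  imports Defs
begin

text \<open>
  The characters of the group diagonalise the adjacency matrix, and the eigenvalue at a character
  \<open>x\<close> is a sum over \<open>d \<in> D\<close> of products of Ramanujan sums. Modulo a power of two, a Ramanujan sum
  equals a sum of signs over the corresponding binary block, once the binary digits of \<open>x\<close> are
  reversed. Hence for tuples sharing their odd part the eigenvalue is an integer multiple of
  \<open>\<Sum>c\<in>C. (-1) ^ f c \<equiv> card C + 2 * (\<Sum>c\<in>C. f c)\<close> (mod \<open>4\<close>), with \<open>f\<close> linear in \<open>c\<close>. So
  \<open>exp (\<i> \<lambda> \<pi> / 2)\<close> does not depend on \<open>x\<close> for members of \<open>script_D'\<close>, while for \<open>script_D_tilde\<close>
  it is, up to a constant phase, the value of the character at the element \<open>z\<close> of order two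
  encoded by the sum of the binary set. This gives perfect state transfer between \<open>0\<close> and \<open>z\<close>.
\<close>

section \<open>Cayley graphs and their characters\<close>

text \<open>The relation \<open>orth\<close> resolves the identity matrix into rank-one terms built
  from \<open>\<phi> x\<close> and \<open>\<psi> x\<close>, and every further factor
  \<open>A\<close> multiplies the term of index \<open>x\<close> by \<open>\<mu> x\<close>.\<close>

lemma matrix_power_spectral:
  fixes A :: "'v \<Rightarrow> 'v \<Rightarrow> complex"
  assumes eig: "\<And>x u. x \<in> X \<Longrightarrow> u \<in> V \<Longrightarrow> (\<Sum>w\<in>V. A u w * \<phi> x w) = \<mu> x * \<phi> x u"
    and orth: "\<And>u v. u \<in> V \<Longrightarrow> v \<in> V \<Longrightarrow> (\<Sum>x\<in>X. \<phi> x u * \<psi> x v) = (if u = v then 1 else 0)"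
    and "u \<in> V" "v \<in> V"
  shows "matrix_power V A k u v = (\<Sum>x\<in>X. \<mu> x ^ k * (\<phi> x u * \<psi> x v))"
  using \<open>u \<in> V\<close>
proof (induction k arbitrary: u)
  case 0
  then show ?case using orth[OF _ \<open>v \<in> V\<close>] by simp
next
  case (Suc k)
  have "matrix_power V A (Suc k) u v
      = (\<Sum>w\<in>V. A u w * (\<Sum>x\<in>X. \<mu> x ^ k * (\<phi> x w * \<psi> x v)))"
    using Suc.IH by simp
  also have "\<dots> = (\<Sum>w\<in>V. \<Sum>x\<in>X. \<mu> x ^ k * \<psi> x v * (A u w * \<phi> x w))"
    by (simp add: sum_distrib_left algebra_simps)
  also have "\<dots> = (\<Sum>x\<in>X. \<Sum>w\<in>V. \<mu> x ^ k * \<psi> x v * (A u w * \<phi> x w))"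
    by (rule sum.swap)
  also have "\<dots> = (\<Sum>x\<in>X. \<mu> x ^ k * \<psi> x v * (\<mu> x * \<phi> x u))"
    using eig Suc.prems by (simp flip: sum_distrib_left)
  finally show ?case by (simp add: algebra_simps)
qed

lemma matrix_exp_spectral:
  fixes A :: "'v \<Rightarrow> 'v \<Rightarrow> complex"
  assumes eig: "\<And>x u. x \<in> X \<Longrightarrow> u \<in> V \<Longrightarrow> (\<Sum>w\<in>V. A u w * \<phi> x w) = \<mu> x * \<phi> x u"
    and orth: "\<And>u v. u \<in> V \<Longrightarrow> v \<in> V \<Longrightarrow> (\<Sum>x\<in>X. \<phi> x u * \<psi> x v) = (if u = v then 1 else 0)"
    and "u \<in> V" "v \<in> V"
  shows "matrix_exp V A u v = (\<Sum>x\<in>X. exp (\<mu> x) * (\<phi> x u * \<psi> x v))"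
proof -
  have "(\<lambda>k. \<Sum>x\<in>X. (\<mu> x ^ k /\<^sub>R fact k) * (\<phi> x u * \<psi> x v))
      sums (\<Sum>x\<in>X. exp (\<mu> x) * (\<phi> x u * \<psi> x v))"
    by (intro sums_sum sums_mult2 exp_converges)
  moreover have "matrix_power V A k u v / fact k
      = (\<Sum>x\<in>X. (\<mu> x ^ k /\<^sub>R fact k) * (\<phi> x u * \<psi> x v))" for k
    using matrix_power_spectral[OF eig orth assms(3,4)]
    by (simp add: sum_divide_distrib scaleR_conv_of_real field_simps)
  ultimately show ?thesis
    unfolding matrix_exp_def by (simp add: sums_iff)
qed

text \<open>Left multiplication by an element of \<open>S\<close> moves along an edge, so a word in
  \<open>S\<close> and its inverses traces a path. The library's connectedness refers to the
  symmetric closure \<open>H\<close>, hence arcs may be used in both directions.\<close>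

lemma (in group) connected_Cay:
  assumes "S \<subseteq> carrier G" "generate G S = carrier G"
  shows "Digraph_Component.connected (with_proj (Cay G S))"
proof -
  define H where "H = with_proj (mk_symmetric (with_proj (Cay G S)))"
  define reach where "reach = rtrancl_on (verts H) (arcs_ends H)"
  have V: "verts H = carrier G"
    by (simp add: H_def mk_symmetric_def Cay_def)
  have E: "arcs_ends H = {(a, b). (a, b) \<in> parcs (Cay G S) \<or> (b, a) \<in> parcs (Cay G S)}"
    by (auto simp: H_def mk_symmetric_def)
  have arcs: "(b, h \<otimes> b) \<in> arcs_ends H" "(h \<otimes> b, b) \<in> arcs_ends H"
    if "h \<in> S" "b \<in> carrier G" for h b
  proof -
    have h: "h \<in> carrier G" using that assms by auto
    have "(h \<otimes> b) \<otimes> inv b = h"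
      using h that by (simp add: m_assoc)
    then have "(h \<otimes> b, b) \<in> parcs (Cay G S)"
      using h that by (simp add: Cay_def)
    then show "(b, h \<otimes> b) \<in> arcs_ends H" "(h \<otimes> b, b) \<in> arcs_ends H"
      unfolding E by simp_all
  qed
  have step: "(b, c) \<in> reach" if "(b, c) \<in> arcs_ends H" "b \<in> carrier G" "c \<in> carrier G" for b c
    using that unfolding reach_def V by (meson rtrancl_on.intros)
  have trans: "(a, c) \<in> reach" if "(a, b) \<in> reach" "(b, c) \<in> reach" for a b c
    using that unfolding reach_def by (rule rtrancl_on_trans)
  \<comment> \<open>Quantifying over the starting point \<open>b\<close> lets the paths of two
    factors be concatenated in the product case.\<close>
  have gen: "\<forall>b\<in>carrier G. (b, h \<otimes> b) \<in> reach" if "h \<in> generate G S" for h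
    using that
  proof induction
    case one
    then show ?case by (auto simp: reach_def V)
  next
    case (incl h)
    then show ?case using arcs step assms by (metis m_closed subsetD)
  next
    case (inv h)
    then have h: "h \<in> carrier G" using assms by auto
    show ?case
    proof
      fix b assume b: "b \<in> carrier G"
      \<comment> \<open>The edge given by \<open>h\<close> at \<open>inv h \<otimes> b\<close> ends
        in \<open>b\<close> and is traversed backwards.\<close>
      have "h \<otimes> (inv h \<otimes> b) = b" using h b by (simp flip: m_assoc)
      then show "(b, inv h \<otimes> b) \<in> reach"
        using arcs(2)[OF inv, of "inv h \<otimes> b"] step h b by simp
    qed
  next
    case (eng h k)
    then have "h \<in> carrier G" "k \<in> carrier G" using assms(2) by auto
    with eng show ?case by (metis m_assoc m_closed trans)
  qed
  have "(u, v) \<in> reach" if "u \<in> carrier G" "v \<in> carrier G" for u v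
  proof -
    have "v \<otimes> inv u \<in> generate G S" using that assms by simp
    from gen[OF this] that have "(u, (v \<otimes> inv u) \<otimes> u) \<in> reach" by simp
    then show ?thesis using that by (simp add: m_assoc)
  qed
  then have "strongly_connected H"
    unfolding strongly_connected_def reachable_def using V by (auto simp: reach_def)
  then show ?thesis
    unfolding Digraph_Component.connected_def H_def .
qed

text \<open>The characters appear as the eigenvectors \<open>cnj (\<chi> x)\<close>, so that the eigenvalues are
  character sums over \<open>S\<close> without a conjugate.\<close>

lemma (in group) transition_matrix_Cay:
  assumes fin: "finite (carrier G)" and S: "S \<subseteq> carrier G" and N: "N \<noteq> 0"
    and hom: "\<And>x a b. x \<in> X \<Longrightarrow> a \<in> carrier G \<Longrightarrow> b \<in> carrier G \<Longrightarrow> \<chi> x (a \<otimes> b) = \<chi> x a * \<chi> x b"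
    and unit: "\<And>x a. x \<in> X \<Longrightarrow> a \<in> carrier G \<Longrightarrow> cmod (\<chi> x a) = 1"
    and orth: "\<And>a b. a \<in> carrier G \<Longrightarrow> b \<in> carrier G \<Longrightarrow>
        (\<Sum>x\<in>X. cnj (\<chi> x a) * \<chi> x b) = (if a = b then N else 0)"
    and u: "u \<in> carrier G" and v: "v \<in> carrier G"
  shows "transition_matrix (Cay G S) t u v
      = (\<Sum>x\<in>X. exp (\<i> * of_real t * (\<Sum>y\<in>S. \<chi> x y)) * (cnj (\<chi> x u) * \<chi> x v)) / N"
proof -
  have eig: "(\<Sum>w\<in>carrier G. (\<i> * of_real t * adjacency_matrix (Cay G S) a w) * cnj (\<chi> x w))
      = (\<i> * of_real t * (\<Sum>y\<in>S. \<chi> x y)) * cnj (\<chi> x a)"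
    if x: "x \<in> X" and a: "a \<in> carrier G" for x a
  proof -
    \<comment> \<open>For a unimodular character, conjugation is inversion. This pulls the value at
      \<open>a\<close> out of the sum and leaves a sum over the quotients in
      \<open>S\<close>.\<close>
    have cnj_eq: "cnj (\<chi> x w) = \<chi> x (a \<otimes> inv w) * cnj (\<chi> x a)" if w: "w \<in> carrier G" for w
    proof -
      have "a = (a \<otimes> inv w) \<otimes> w" using a w by (simp add: m_assoc)
      then have eq: "\<chi> x a = \<chi> x (a \<otimes> inv w) * \<chi> x w"
        using hom[OF x] a w by (metis inv_closed m_closed)
      have one: "\<chi> x b * cnj (\<chi> x b) = 1" if "b \<in> carrier G" for b
        using unit[OF x that] by (simp flip: complex_norm_square)
      have "\<chi> x (a \<otimes> inv w) * cnj (\<chi> x a)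
          = (\<chi> x (a \<otimes> inv w) * cnj (\<chi> x (a \<otimes> inv w))) * cnj (\<chi> x w)"
        using arg_cong[OF eq, of cnj] by simp
      also have "\<dots> = cnj (\<chi> x w)" using one a w by simp
      finally show ?thesis by simp
    qed
    have "(\<Sum>w\<in>carrier G. adjacency_matrix (Cay G S) a w * cnj (\<chi> x w))
        = (\<Sum>w\<in>carrier G. if a \<otimes> inv w \<in> S then cnj (\<chi> x w) else 0)"
      using a by (intro sum.cong) (auto simp: adjacency_matrix_def Cay_def)
    also have "\<dots> = (\<Sum>w | w \<in> carrier G \<and> a \<otimes> inv w \<in> S. cnj (\<chi> x w))"
      by (simp add: sum.If_cases fin Int_def)
    also have "\<dots> = (\<Sum>y\<in>S. \<chi> x y * cnj (\<chi> x a))"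
    proof (rule sum.reindex_bij_witness[where i = "\<lambda>y. inv y \<otimes> a" and j = "\<lambda>w. a \<otimes> inv w"])
      fix y assume "y \<in> S"
      then have y: "y \<in> carrier G" using S by auto
      show "a \<otimes> inv (inv y \<otimes> a) = y"
        using a y by (simp add: inv_mult_group flip: m_assoc)
      then show "inv y \<otimes> a \<in> {w \<in> carrier G. a \<otimes> inv w \<in> S}"
        using a y \<open>y \<in> S\<close> by simp
    next
      fix w assume "w \<in> {w \<in> carrier G. a \<otimes> inv w \<in> S}"
      then have w: "w \<in> carrier G" "a \<otimes> inv w \<in> S" by auto
      show "inv (a \<otimes> inv w) \<otimes> a = w"
        using a w by (simp add: inv_mult_group m_assoc)
      show "\<chi> x (a \<otimes> inv w) * cnj (\<chi> x a) = cnj (\<chi> x w)" using cnj_eq w by simp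
    qed auto
    finally show ?thesis
      by (simp add: sum_distrib_left sum_distrib_right mult.assoc flip: sum_distrib_left)
  qed
  have "pverts (Cay G S) = carrier G" by (simp add: Cay_def)
  \<comment> \<open>The dual family is \<open>\<chi> x v / N\<close>: dividing by \<open>N\<close>
    turns orthogonality into the resolution of the identity.\<close>
  then show ?thesis
    unfolding transition_matrix_def
    using matrix_exp_spectral[of X "carrier G" "\<lambda>u v. \<i> * of_real t * adjacency_matrix (Cay G S) u v"
        "\<lambda>x w. cnj (\<chi> x w)" "\<lambda>x. \<i> * of_real t * (\<Sum>y\<in>S. \<chi> x y)" "\<lambda>x v. \<chi> x v / N" u v]
      eig orth N u v
    by (simp add: sum_divide_distrib[symmetric])
qed

text \<open>If the phase at each character is a constant times its value at \<open>z\<close>, it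
  cancels the factor \<open>cnj (\<chi> x z)\<close> in the entry from \<open>z\<close> to the
  neutral element. All terms then add up in phase and the entry is \<open>\<kappa>\<close>.\<close>

lemma (in group) admits_PST_Cay:
  assumes fin: "finite (carrier G)" and S: "S \<subseteq> carrier G" and N: "N \<noteq> 0"
    and hom: "\<And>x a b. x \<in> X \<Longrightarrow> a \<in> carrier G \<Longrightarrow> b \<in> carrier G \<Longrightarrow> \<chi> x (a \<otimes> b) = \<chi> x a * \<chi> x b"
    and unit: "\<And>x a. x \<in> X \<Longrightarrow> a \<in> carrier G \<Longrightarrow> cmod (\<chi> x a) = 1"
    and orth: "\<And>a b. a \<in> carrier G \<Longrightarrow> b \<in> carrier G \<Longrightarrow>
        (\<Sum>x\<in>X. cnj (\<chi> x a) * \<chi> x b) = (if a = b then N else 0)"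
    and z: "z \<in> carrier G" "z \<noteq> \<one>" and \<kappa>: "cmod \<kappa> = 1"
    and phase: "\<And>x. x \<in> X \<Longrightarrow> exp (\<i> * of_real t * (\<Sum>y\<in>S. \<chi> x y)) = \<kappa> * \<chi> x z"
  shows "admits_PST (Cay G S) t"
proof -
  \<comment> \<open>The value is idempotent by \<open>hom\<close> and nonzero by
    \<open>unit\<close>.\<close>
  have one: "\<chi> x \<one> = 1" if "x \<in> X" for x
    using hom[OF that, of \<one> \<one>] unit[OF that, of \<one>] by auto
  have "transition_matrix (Cay G S) t z \<one>
      = (\<Sum>x\<in>X. exp (\<i> * of_real t * (\<Sum>y\<in>S. \<chi> x y)) * (cnj (\<chi> x z) * \<chi> x \<one>)) / N"
    using transition_matrix_Cay[OF fin S N hom unit orth] z by simp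
  also have "(\<Sum>x\<in>X. exp (\<i> * of_real t * (\<Sum>y\<in>S. \<chi> x y)) * (cnj (\<chi> x z) * \<chi> x \<one>))
      = (\<Sum>x\<in>X. \<kappa> * (cnj (\<chi> x z) * \<chi> x z))"
    using phase one by (intro sum.cong) auto
  also have "\<dots> = \<kappa> * N" using orth[OF z(1) z(1)] by (simp flip: sum_distrib_left)
  finally have "transition_matrix (Cay G S) t z \<one> = \<kappa>" using N by simp
  then show ?thesis
    unfolding admits_PST_def using z \<kappa> by (force simp: Cay_def)
qed

section \<open>Roots of unity and Ramanujan sums\<close>

definition unit_root :: "nat \<Rightarrow> int \<Rightarrow> complex" where
  "unit_root N k = cis (2 * pi * (of_int k / of_nat N))"

lemma unit_root_add: "unit_root N (a + b) = unit_root N a * unit_root N b"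
  by (simp add: unit_root_def cis_mult add_divide_distrib ring_distribs)

lemma norm_unit_root [simp]: "cmod (unit_root N k) = 1"
  by (simp add: unit_root_def)

lemma cnj_unit_root: "cnj (unit_root N k) = unit_root N (- k)"
  by (simp add: unit_root_def cis_cnj)

lemma unit_root_power: "unit_root N k ^ j = unit_root N (k * int j)"
  by (simp add: unit_root_def DeMoivre field_simps)

lemma unit_root_eq_1_iff:
  assumes "N > 0"
  shows "unit_root N k = 1 \<longleftrightarrow> int N dvd k"
proof
  assume "unit_root N k = 1"
  then have "cos (2 * pi * (of_int k / of_nat N)) = 1"
    by (simp add: unit_root_def complex_eq_iff)
  then obtain l :: int where "2 * pi * (of_int k / of_nat N) = of_int l * 2 * pi"
    by (auto simp: cos_one_2pi_int)
  then have "(of_int k :: real) = of_int (l * int N)"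
    using assms by (simp add: field_simps)
  then have "k = l * int N" by (simp only: of_int_eq_iff)
  then show "int N dvd k" by simp
next
  assume "int N dvd k"
  then obtain l where "k = int N * l" by auto
  then show "unit_root N k = 1" using assms by (simp add: unit_root_def)
qed

lemma unit_root_mod: "N > 0 \<Longrightarrow> unit_root N (k mod int N) = unit_root N k"
proof -
  assume N: "N > 0"
  have "unit_root N k = unit_root N (int N * (k div int N) + k mod int N)" by simp
  also have "\<dots> = unit_root N (int N * (k div int N)) * unit_root N (k mod int N)"
    by (rule unit_root_add)
  also have "unit_root N (int N * (k div int N)) = 1" using N by (simp add: unit_root_eq_1_iff)
  finally show ?thesis by simp
qed

lemma unit_root_cong:
  assumes "N > 0" "a mod int N = b mod int N"
  shows "unit_root N a = unit_root N b"
  using unit_root_mod[OF assms(1)] assms(2) by metis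

lemma unit_root_mult_cancel:
  assumes "d > 0"
  shows "unit_root (d * N) (int d * k) = unit_root N k"
  using assms by (simp add: unit_root_def)

lemma sum_unit_root:
  assumes "N > 0"
  shows "(\<Sum>y\<in>{0..<int N}. unit_root N (x * y)) = (if int N dvd x then of_nat N else 0)"
proof -
  have "(\<Sum>y\<in>{0..<int N}. unit_root N (x * y)) = (\<Sum>j<N. unit_root N x ^ j)"
    by (rule sum.reindex_bij_witness[of _ int nat]) (auto simp: unit_root_power)
  also have "\<dots> = (if int N dvd x then of_nat N else 0)"
  proof (cases "int N dvd x")
    case True
    then have "unit_root N x = 1" using assms by (simp add: unit_root_eq_1_iff)
    with True show ?thesis by simp
  next
    case False
    then have "unit_root N x \<noteq> 1" using assms by (simp add: unit_root_eq_1_iff)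
    moreover have "unit_root N x ^ N = 1" using assms by (simp add: unit_root_power unit_root_eq_1_iff)
    ultimately show ?thesis using False by (simp add: geometric_sum)
  qed
  finally show ?thesis .
qed

text \<open>Substituting \<open>y = d * l\<close> gives a full geometric sum for the modulus
  \<open>N div d\<close>.\<close>

lemma sum_unit_root_multiples:
  assumes "N > 0" "d dvd N"
  shows "(\<Sum>y | y \<in> {0..<int N} \<and> int d dvd y. unit_root N (x * y))
    = (if int (N div d) dvd x then of_nat (N div d) else 0)"
proof -
  obtain M where M: "N = d * M" using assms by auto
  with assms have pos: "d > 0" "M > 0" by auto
  have "(\<Sum>y | y \<in> {0..<int N} \<and> int d dvd y. unit_root N (x * y))
      = (\<Sum>y\<in>{0..<int M}. unit_root M (x * y))"
  proof (rule sum.reindex_bij_witness[of _ "\<lambda>y. int d * y" "\<lambda>y. y div int d"])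
    fix y assume "y \<in> {y. y \<in> {0..<int N} \<and> int d dvd y}"
    then obtain l where y: "y = int d * l" "0 \<le> int d * l" "int d * l < int d * int M"
      by (auto simp: M)
    show "int d * (y div int d) = y" using y by simp
    show "y div int d \<in> {0..<int M}"
      using y pos by (simp add: zero_le_mult_iff)
    have "x * y = int d * (x * l)" using y by simp
    then show "unit_root M (x * (y div int d)) = unit_root N (x * y)"
      using y(1) pos unit_root_mult_cancel[OF pos(1), of M "x * l"] unfolding M
      by (simp add: mult.left_commute)
  next
    fix l assume "l \<in> {0..<int M}"
    then show "int d * l \<in> {y. y \<in> {0..<int N} \<and> int d dvd y}" "int d * l div int d = l"
      using pos by (auto simp: M)
  qed
  then show ?thesis using sum_unit_root[OF pos(2)] pos by (simp add: M)
qed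

text \<open>For \<open>d\<close> dividing a positive \<open>N\<close>, dividing \<open>y\<close> by
  \<open>d\<close> shows that this is the classical Ramanujan sum of order \<open>N / d\<close> at
  \<open>x\<close>.\<close>

definition ramanujan_sum :: "nat \<Rightarrow> nat \<Rightarrow> int \<Rightarrow> complex" where
  "ramanujan_sum N d x
    = (\<Sum>y | y \<in> {0..<int N} \<and> gcd y (int N) = int d. unit_root N (x * y))"

lemma ramanujan_sum_self: "N > 0 \<Longrightarrow> ramanujan_sum N N x = 1"
proof -
  assume N: "N > 0"
  have "y = 0" if "y \<in> {0..<int N}" "gcd y (int N) = int N" for y
    using that gcd_dvd1[of y "int N"] zdvd_not_zless[of y "int N"] by fastforce
  then have "{y. y \<in> {0..<int N} \<and> gcd y (int N) = int N} = {0}" using N by auto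
  then show ?thesis using N by (simp add: ramanujan_sum_def unit_root_def)
qed

text \<open>The gcd is a power of \<open>p\<close>, so it is pinned down by the largest exponent
  that works. Since \<open>k < m\<close>, the next power \<open>p ^ Suc k\<close> still divides the
  modulus and can serve as the test.\<close>

lemma gcd_prime_power_eq_iff:
  fixes p :: nat and y :: int
  assumes "prime p" "k < m"
  shows "gcd y (int (p ^ m)) = int (p ^ k) \<longleftrightarrow> int (p ^ k) dvd y \<and> \<not> int (p ^ Suc k) dvd y"
proof
  assume eq: "gcd y (int (p ^ m)) = int (p ^ k)"
  have "int (p ^ k) dvd y" using eq gcd_dvd1 by metis
  moreover have "\<not> int (p ^ Suc k) dvd y"
  proof
    assume "int (p ^ Suc k) dvd y"
    moreover have "int (p ^ Suc k) dvd int (p ^ m)"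
      using assms by (subst int_dvd_int_iff) (rule le_imp_power_dvd, simp)
    ultimately have "int (p ^ Suc k) dvd int (p ^ k)" using eq by (metis gcd_greatest)
    then have "p ^ Suc k dvd p ^ k" by (simp only: int_dvd_int_iff)
    then have "Suc k \<le> k"
      using power_dvd_imp_le[of p "Suc k" k] prime_gt_1_nat[OF assms(1)] by simp
    then show False by simp
  qed
  ultimately show "int (p ^ k) dvd y \<and> \<not> int (p ^ Suc k) dvd y" ..
next
  assume A: "int (p ^ k) dvd y \<and> \<not> int (p ^ Suc k) dvd y"
  have g: "gcd y (int (p ^ m)) = int (gcd (nat \<bar>y\<bar>) (p ^ m))"
    by (metis gcd_int_int_eq gcd_abs1_int int_nat_eq abs_ge_zero)
  obtain j where j: "j \<le> m" "gcd (nat \<bar>y\<bar>) (p ^ m) = p ^ j"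
    using divides_primepow_nat[OF assms(1)] gcd_dvd2 by metis
  have k: "p ^ k dvd gcd (nat \<bar>y\<bar>) (p ^ m)"
    using A assms by (intro gcd_greatest) (auto intro: le_imp_power_dvd simp: nat_dvd_iff nat_abs_dvd_iff dvd_nat_abs_iff simp del: of_nat_power)
  then have "k \<le> j"
    using j power_dvd_imp_le[of p k j] prime_gt_1_nat[OF assms(1)] by simp
  moreover have "\<not> Suc k \<le> j"
  proof
    assume "Suc k \<le> j"
    then have "int (p ^ Suc k) dvd int (p ^ j)"
      by (subst int_dvd_int_iff) (rule le_imp_power_dvd)
    also have "int (p ^ j) dvd y" using g j gcd_dvd1 by metis
    finally show False using A by simp
  qed
  ultimately have "j = k" by simp
  then show "gcd y (int (p ^ m)) = int (p ^ k)" using g j(2) by (simp only:)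
qed

text \<open>The gcd class consists of the multiples of \<open>p ^ k\<close> without the multiples of
  \<open>p ^ Suc k\<close>; each of the two sums is geometric.\<close>

lemma ramanujan_sum_prime_power:
  assumes "prime p" "k < m"
  shows "ramanujan_sum (p ^ m) (p ^ k) x
    = of_int ((if int p ^ (m - k) dvd x then int p ^ (m - k) else 0)
      - (if int p ^ (m - Suc k) dvd x then int p ^ (m - Suc k) else 0))"
proof -
  let ?M = "\<lambda>k. {y. y \<in> {0..<int (p ^ m)} \<and> int (p ^ k) dvd y}"
  have p: "p > 0" using assms prime_gt_0_nat by blast
  have sum: "(\<Sum>y\<in>?M j. unit_root (p ^ m) (x * y))
      = (if int (p ^ (m - j)) dvd x then of_nat (p ^ (m - j)) else 0)" if "j \<le> m" for j
  proof -
    have "p ^ m div p ^ j = p ^ (m - j)" using p that by (simp add: power_diff)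
    then show ?thesis
      using sum_unit_root_multiples[of "p ^ m" "p ^ j" x] p that
      by (simp add: le_imp_power_dvd del: of_nat_power)
  qed
  have sub: "?M (Suc k) \<subseteq> ?M k"
    by (auto dest: dvd_mult_right)
  have fin: "finite (?M j)" for j by (rule finite_subset[of _ "{0..<int (p ^ m)}"]) auto
  have "ramanujan_sum (p ^ m) (p ^ k) x = (\<Sum>y\<in>?M k - ?M (Suc k). unit_root (p ^ m) (x * y))"
    unfolding ramanujan_sum_def
    by (rule sum.cong) (use gcd_prime_power_eq_iff[OF assms] in \<open>auto simp del: of_nat_power power_Suc\<close>)
  also have "\<dots> = (\<Sum>y\<in>?M k. unit_root (p ^ m) (x * y)) - (\<Sum>y\<in>?M (Suc k). unit_root (p ^ m) (x * y))"
    using sub fin by (simp add: sum_diff)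
  finally show ?thesis using sum[of k] sum[of "Suc k"] assms by simp
qed

text \<open>This makes the contribution of the odd components to an eigenvalue an integer
  factor.\<close>

lemma ramanujan_sum_prime_power_in_Ints:
  assumes "prime p" "d dvd p ^ m"
  shows "ramanujan_sum (p ^ m) d x \<in> \<int>"
proof -
  obtain k where k: "k \<le> m" "d = p ^ k" using assms divides_primepow_nat by blast
  show ?thesis
  proof (cases "k = m")
    case True
    then show ?thesis using k assms ramanujan_sum_self[of "p ^ m"] prime_gt_0_nat by simp
  next
    case False
    then show ?thesis using k ramanujan_sum_prime_power[OF assms(1), of k m x] Ints_of_int by force
  qed
qed

section \<open>Binary blocks\<close>

definition bit_sign :: "bit \<Rightarrow> int" where
  "bit_sign b = (if b = 0 then 1 else - 1)"

lemma bit_sign_simps [simp]: "bit_sign 0 = 1" "bit_sign 1 = - 1"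
  by (simp_all add: bit_sign_def)

lemma bit_sign_add: "bit_sign (a + b) = bit_sign a * bit_sign b"
  by (cases a; cases b) auto

lemma bit_sign_sum: "bit_sign (sum f A) = (\<Prod>x\<in>A. bit_sign (f x))"
proof (induction A rule: infinite_finite_induct)
  case (insert x A)
  then show ?case
    unfolding sum.insert[OF insert.hyps] prod.insert[OF insert.hyps] bit_sign_add by simp
qed auto

text \<open>With a bit b read as 0 or 1, its sign is 1 - 2b, which is 1 + 2b modulo 4. In the sum,
  the terms 2b matter only through the parity of the number of ones.\<close>

lemma sum_bit_sign_mod_4:
  "(\<Sum>c\<in>C. bit_sign (f c)) mod 4 = (int (card C) + (if sum f C = 0 then 0 else 2)) mod 4"
proof -
  have "\<exists>q. (\<Sum>c\<in>C. bit_sign (f c)) = int (card C) + (if sum f C = 0 then 0 else 2) + 4 * q"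
  proof (induction C rule: infinite_finite_induct)
    case (insert x C)
    then obtain q where q: "(\<Sum>c\<in>C. bit_sign (f c)) = int (card C) + (if sum f C = 0 then 0 else 2) + 4 * q"
      by blast
    \<comment> \<open>A new element with \<open>f x = 1\<close> lowers the sign sum by 1. The first
      two terms on the right rise by 3 if the parity was 0, which \<open>q\<close> offsets by
      dropping 1, and fall by 1 otherwise.\<close>
    then have "(\<Sum>c\<in>insert x C. bit_sign (f c)) = int (card (insert x C))
        + (if sum f (insert x C) = 0 then 0 else 2)
        + 4 * (q - (if f x = 0 then 0 else if sum f C = 0 then 1 else 0))"
      using insert.hyps by (cases "f x"; cases "sum f C") simp_all
    then show ?case by blast
  qed auto
  then obtain q where "(\<Sum>c\<in>C. bit_sign (f c)) = int (card C) + (if sum f C = 0 then 0 else 2) + 4 * q"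
    by blast
  then show ?thesis by simp
qed

lemma UNIV_bit: "(UNIV :: bit set) = {0, 1}"
proof -
  have "b \<in> {0, 1}" for b :: bit by (cases b) auto
  then show ?thesis by auto
qed

text \<open>Bits are read off from the top: coordinate \<open>n - 1\<close> is the parity of \<open>x\<close>. With this
  reversal the Ramanujan sums over \<open>\<int>\<close> modulo \<open>2\<^sup>n\<close> become sign sums over binary blocks.\<close>

definition rev_digit :: "nat \<Rightarrow> int \<Rightarrow> nat \<Rightarrow> bit" where
  "rev_digit n x j = of_bool (odd (x div 2 ^ (n - Suc j)))"

text \<open>A digit 0 contributes the factor 2 and a digit 1 the factor 0, so only numbers whose
  lowest \<open>L\<close> digits all vanish survive.\<close>

lemma prod_low_digits:
  "(\<Prod>l<L. 1 + bit_sign (of_bool (odd (x div 2 ^ l)))) = (if 2 ^ L dvd x then 2 ^ L else 0)" for x :: int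
proof (induction L)
  case (Suc L)
  have "2 ^ Suc L dvd x \<longleftrightarrow> 2 ^ L dvd x \<and> even (x div 2 ^ L)"
  proof
    assume "2 ^ Suc L dvd x"
    then obtain y where "x = 2 ^ L * (2 * y)" by (auto simp: mult_ac)
    then show "2 ^ L dvd x \<and> even (x div 2 ^ L)" by simp
  next
    assume A: "2 ^ L dvd x \<and> even (x div 2 ^ L)"
    then have "2 * 2 ^ L dvd x div 2 ^ L * 2 ^ L" by (intro mult_dvd_mono) auto
    then show "2 ^ Suc L dvd x" using A by simp
  qed
  then show ?case using Suc by simp
qed auto

text \<open>As a product of coordinate sets, a block allows sums over it to factor. One formula
  covers both cases of the definition: for \<open>k = n\<close> no coordinate has index
  \<open>k\<close>, and all are 0.\<close>

lemma binary_block_eq_PiE: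
  assumes "k \<le> n"
  shows "binary_block n (2 ^ k)
    = (\<Pi>\<^sub>E j\<in>{..<n}. if j < k then {0} else if j = k then {1} else UNIV)"
proof -
  have m: "multiplicity 2 (2 ^ k :: nat) = k" by simp
  show ?thesis
  proof (cases "k < n")
    case True
    have iff: "c \<in> {..<n} \<rightarrow>\<^sub>E UNIV \<and> (\<forall>j<k. c j = 0) \<and> c k = 1 \<longleftrightarrow>
        c \<in> (\<Pi>\<^sub>E j\<in>{..<n}. if j < k then {0} else if j = k then {1} else UNIV)" (is "?L \<longleftrightarrow> ?R")
      for c :: "nat \<Rightarrow> bit"
    proof
      assume ?L
      then show ?R by (auto simp: PiE_iff)
    next
      assume R: ?R
      have "c j \<in> (if j < k then {0} else if j = k then {1} else UNIV)" if "j < n" for j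
        using PiE_mem[OF R] that by blast
      from this[of k] this have "c k = 1" "\<forall>j<k. c j = 0"
        using True by (simp, metis less_trans singletonD)
      then show ?L using R PiE_iff by blast
    qed
    have "{c \<in> {..<n} \<rightarrow>\<^sub>E UNIV. (\<forall>j<k. c j = (0 :: bit)) \<and> c k = 1}
        = (\<Pi>\<^sub>E j\<in>{..<n}. if j < k then {0} else if j = k then {1} else UNIV)"
      by (rule Set.set_eqI) (simp only: mem_Collect_eq iff)
    with True show ?thesis
      unfolding binary_block_def Let_def m by (simp only: if_True)
  next
    case False
    then have "(\<Pi>\<^sub>E j\<in>{..<n}. if j < k then {0} else if j = k then {1} else UNIV)
        = (\<Pi>\<^sub>E j\<in>{..<n}. {0 :: bit})"
      using assms by (intro PiE_cong) auto
    also have "\<dots> = (\<Pi>\<^sub>E j\<in>{..<n}. {(\<lambda>j\<in>{..<n}. 0) j})" by (intro PiE_cong) simp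
    also have "\<dots> = {\<lambda>j\<in>{..<n}. 0}" by (rule PiE_singleton) (rule restrict_extensional)
    finally show ?thesis using False unfolding binary_block_def Let_def m by simp
  qed
qed

lemma finite_binary_block:
  assumes "d dvd 2 ^ n"
  shows "finite (binary_block n d)"
proof -
  obtain k where "k \<le> n" "d = 2 ^ k" using assms divides_primepow_nat[OF two_is_prime_nat] by blast
  then show ?thesis by (auto simp: binary_block_eq_PiE UNIV_bit intro!: finite_PiE)
qed

text \<open>The exponent of \<open>d\<close> is the position of the first 1 in \<open>c\<close>, or
  \<open>n\<close> if there is none.\<close>

lemma binary_block_disjoint:
  assumes "d dvd 2 ^ n" "e dvd 2 ^ n" "c \<in> binary_block n d" "c \<in> binary_block n e"
  shows "d = e"
proof -
  obtain k l where k: "k \<le> n" "d = 2 ^ k" and l: "l \<le> n" "e = 2 ^ l"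
    using assms(1,2) divides_primepow_nat[OF two_is_prime_nat] by metis
  have *: False if "k < l" "l \<le> n" "c \<in> binary_block n (2 ^ k)" "c \<in> binary_block n (2 ^ l)" for k l
  proof -
    have "k < n" "k \<le> n" using that by simp_all
    have "c k = 1"
      using PiE_mem[OF that(3)[unfolded binary_block_eq_PiE[OF \<open>k \<le> n\<close>]], of k] \<open>k < n\<close> by simp
    moreover have "c k = 0"
      using PiE_mem[OF that(4)[unfolded binary_block_eq_PiE[OF \<open>l \<le> n\<close>]], of k] \<open>k < n\<close> that(1)
      by simp
    ultimately show False by simp
  qed
  have "k = l"
    using *[of k l] *[of l k] assms(3,4) k l by (metis linorder_neqE_nat)
  then show ?thesis using k l by simp
qed

text \<open>The sign of a linear form is a product over coordinates, so the sum factors. Fixed zeros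
  give 1, the leading 1 gives the sign of one digit of \<open>x\<close>, and the free coordinates
  test divisibility of \<open>x\<close> by a power of two.\<close>

lemma sum_bit_sign_binary_block:
  assumes "d dvd 2 ^ n"
  shows "of_int (\<Sum>c\<in>binary_block n d. bit_sign (\<Sum>j<n. rev_digit n x j * c j)) = ramanujan_sum (2 ^ n) d x"
proof -
  obtain k where k: "k \<le> n" and d: "d = 2 ^ k"
    using assms divides_primepow_nat[OF two_is_prime_nat] by blast
  define b where "b = (\<lambda>l. bit_sign (of_bool (odd (x div 2 ^ l))))"
  define F where "F = (\<lambda>j. \<Sum>v\<in>(if j < k then {0} else if j = k then {1} else UNIV). bit_sign (rev_digit n x j * v))"
  have F: "F j = (if j < k then 1 else if j = k then b (n - Suc k) else 1 + b (n - Suc j))" for j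
    by (simp add: F_def UNIV_bit b_def rev_digit_def)
  have "(\<Sum>c\<in>binary_block n d. bit_sign (\<Sum>j<n. rev_digit n x j * c j)) = (\<Prod>j<n. F j)"
    unfolding d binary_block_eq_PiE[OF k] F_def
    by (subst prod_sum_PiE) (simp_all only: bit_sign_sum finite_lessThan finite.intros UNIV_bit split: if_split, simp)
  also have "\<dots> = (\<Prod>l<n. F (n - Suc l))" by (rule prod.nat_diff_reindex[symmetric])
  also have "of_int \<dots> = ramanujan_sum (2 ^ n) d x"
  proof (cases "k = n")
    case True
    then have "(\<Prod>l<n. F (n - Suc l)) = 1" by (intro prod.neutral) (auto simp: F)
    then show ?thesis using True ramanujan_sum_self[of "2 ^ n" x] d by simp
  next
    case False
    define L where "L = n - Suc k"
    have n: "n = Suc L + k" using False k by (simp add: L_def)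
    \<comment> \<open>The indices beyond \<open>L\<close> belong to the coordinates below
      \<open>k\<close>, whose factor is 1.\<close>
    have "(\<Prod>l<n. F (n - Suc l)) = (\<Prod>l<Suc L. F (n - Suc l))"
      by (rule prod.mono_neutral_right) (auto simp: n F)
    also have "\<dots> = (\<Prod>l<L. F (n - Suc l)) * F (n - Suc L)" by simp
    also have "(\<Prod>l<L. F (n - Suc l)) = (\<Prod>l<L. 1 + b l)"
      by (rule prod.cong) (auto simp: n F)
    also have "F (n - Suc L) = b L" by (simp add: n F)
    \<comment> \<open>Writing \<open>b L\<close> as \<open>(1 + b L) - 1\<close> gives the
      difference of the products of lengths \<open>Suc L\<close> and \<open>L\<close>, which is the
      shape of the Ramanujan sum for \<open>p = 2\<close>.\<close>
    also have "(\<Prod>l<L. 1 + b l) * b L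
        = (if 2 ^ Suc L dvd x then 2 ^ Suc L else 0) - (if 2 ^ L dvd x then 2 ^ L else 0)"
      using prod_low_digits[of x L] prod_low_digits[of x "Suc L"]
      by (simp add: b_def algebra_simps)
    finally show ?thesis
      using ramanujan_sum_prime_power[OF two_is_prime_nat, of k n x] k False
      by (simp add: d n Suc_diff_le)
  qed
  finally show ?thesis by simp
qed

text \<open>Either coordinate \<open>j\<close> is 0 throughout the block, or
  \<open>k \<le> j < n - 1\<close>. In the latter case the last coordinate is free, and flipping it
  pairs vectors with equal \<open>c j\<close>.\<close>

lemma sum_binary_block_coordinate:
  assumes "d dvd 2 ^ n" "Suc j < n"
  shows "(\<Sum>c\<in>binary_block n d. c j) = 0"
proof -
  obtain k where k: "k \<le> n" and d: "d = 2 ^ k"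
    using assms divides_primepow_nat[OF two_is_prime_nat] by blast
  let ?B = "\<lambda>j. if j < k then {0} else if j = k then {1} else UNIV :: bit set"
  \<comment> \<open>Padding with factors 1 turns the summand into a product over coordinates; a free
    coordinate other than \<open>j\<close> then contributes 1 + 1 = 0.\<close>
  have "(\<Sum>c\<in>binary_block n d. c j)
      = (\<Sum>c\<in>binary_block n d. \<Prod>i<n. if i = j then c i else 1)"
    using assms(2) by (simp add: prod.delta)
  also have "\<dots> = (\<Prod>i<n. \<Sum>v\<in>?B i. if i = j then v else 1)"
    unfolding d binary_block_eq_PiE[OF k]
    by (subst prod_sum_PiE) (auto simp: UNIV_bit)
  also have "\<dots> = 0"
  proof (cases "j < k")
    case True
    then show ?thesis using assms(2) by (intro prod_zero) (auto intro!: bexI[of _ j])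
  next
    case False
    then show ?thesis using assms(2) 
      by (intro prod_zero) (auto simp: UNIV_bit intro!: bexI[of _ "n - 1"])
  qed
  finally show ?thesis .
qed

section \<open>Sums over the binary set of a family of tuples\<close>

context
  fixes r :: nat and n :: "nat \<Rightarrow> nat" and D :: "(nat \<Rightarrow> nat) set"
  assumes fin: "finite D"
    and dvd: "\<forall>d\<in>D. \<forall>i<r. d i dvd 2 ^ n i"
    and sep: "\<forall>d\<in>D. \<forall>e\<in>D. (\<forall>i<r. d i = e i) \<longrightarrow> d = e"
begin

text \<open>By \<open>sep\<close>, distinct tuples differ in some 2-component, so their boxes are
  disjoint; over a single box the sum factors.\<close>

lemma sum_binary_set:
  fixes f :: "nat \<Rightarrow> (nat \<Rightarrow> bit) \<Rightarrow> 'a :: comm_semiring_1"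
  shows "(\<Sum>c\<in>binary_set r n D. \<Prod>i<r. f i (c i)) = (\<Sum>d\<in>D. \<Prod>i<r. \<Sum>b\<in>binary_block (n i) (d i). f i b)"
proof -
  have fin_block: "finite (binary_block (n i) (d i))" if "d \<in> D" "i < r" for d i
    using dvd finite_binary_block that by blast
  have "(\<Sum>c\<in>binary_set r n D. \<Prod>i<r. f i (c i))
      = (\<Sum>d\<in>D. \<Sum>c\<in>(\<Pi>\<^sub>E i\<in>{..<r}. binary_block (n i) (d i)). \<Prod>i<r. f i (c i))"
    unfolding binary_set_def
  proof (rule sum.UNION_disjoint)
    show "\<forall>d\<in>D. finite (\<Pi>\<^sub>E i\<in>{..<r}. binary_block (n i) (d i))"
      using fin_block by (auto intro!: finite_PiE)
    show "\<forall>d\<in>D. \<forall>e\<in>D. d \<noteq> e \<longrightarrow>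
        (\<Pi>\<^sub>E i\<in>{..<r}. binary_block (n i) (d i)) \<inter> (\<Pi>\<^sub>E i\<in>{..<r}. binary_block (n i) (e i)) = {}"
    proof (intro ballI impI, rule ccontr)
      fix d e assume de: "d \<in> D" "e \<in> D" "d \<noteq> e"
        and "(\<Pi>\<^sub>E i\<in>{..<r}. binary_block (n i) (d i)) \<inter> (\<Pi>\<^sub>E i\<in>{..<r}. binary_block (n i) (e i)) \<noteq> {}"
      then obtain c where "\<And>i. i < r \<Longrightarrow> c i \<in> binary_block (n i) (d i)"
          "\<And>i. i < r \<Longrightarrow> c i \<in> binary_block (n i) (e i)"
        by (auto simp: PiE_iff)
      then have "d i = e i" if "i < r" for i
        using that binary_block_disjoint dvd de by meson
      then show False using sep de by blast
    qed
  qed (rule fin)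
  also have "\<dots> = (\<Sum>d\<in>D. \<Prod>i<r. \<Sum>b\<in>binary_block (n i) (d i). f i b)"
    using fin_block by (intro sum.cong refl prod_sum_PiE[symmetric]) auto
  finally show ?thesis .
qed

lemma sum_prod_ramanujan_sum:
  "(\<Sum>d\<in>D. \<Prod>i<r. ramanujan_sum (2 ^ n i) (d i) (x i))
    = of_int (\<Sum>c\<in>binary_set r n D. bit_sign (\<Sum>i<r. \<Sum>j<n i. rev_digit (n i) (x i) j * c i j))"
proof -
  have "(\<Sum>c\<in>binary_set r n D. bit_sign (\<Sum>i<r. \<Sum>j<n i. rev_digit (n i) (x i) j * c i j))
      = (\<Sum>d\<in>D. \<Prod>i<r. \<Sum>b\<in>binary_block (n i) (d i). bit_sign (\<Sum>j<n i. rev_digit (n i) (x i) j * b j))"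
    unfolding bit_sign_sum[of _ "{..<r}"] by (rule sum_binary_set)
  then have "of_int (\<Sum>c\<in>binary_set r n D. bit_sign (\<Sum>i<r. \<Sum>j<n i. rev_digit (n i) (x i) j * c i j))
      = (\<Sum>d\<in>D. \<Prod>i<r. of_int (\<Sum>b\<in>binary_block (n i) (d i).
          bit_sign (\<Sum>j<n i. rev_digit (n i) (x i) j * b j)) :: complex)"
    by (simp only: of_int_sum of_int_prod)
  also have "\<dots> = (\<Sum>d\<in>D. \<Prod>i<r. ramanujan_sum (2 ^ n i) (d i) (x i))"
    using dvd by (intro sum.cong prod.cong refl sum_bit_sign_binary_block) auto
  finally show ?thesis by simp
qed

lemma sum_binary_set_coordinate:
  assumes "i < r" "Suc j < n i"
  shows "(\<Sum>c\<in>binary_set r n D. c i j) = 0"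
proof -
  have "(\<Sum>c\<in>binary_set r n D. c i j)
      = (\<Sum>c\<in>binary_set r n D. \<Prod>i'<r. (if i' = i then c i' j else 1))"
    using assms(1) by (simp add: prod.delta)
  also have "\<dots> = (\<Sum>d\<in>D. \<Prod>i'<r. \<Sum>b\<in>binary_block (n i') (d i'). if i' = i then b j else 1)"
    by (rule sum_binary_set)
  also have "\<dots> = 0"
  proof (intro sum.neutral ballI prod_zero)
    fix d assume "d \<in> D"
    then show "\<exists>i'\<in>{..<r}. (\<Sum>b\<in>binary_block (n i') (d i'). if i' = i then b j else 1) = 0"
      using assms dvd sum_binary_block_coordinate by (intro bexI[of _ i]) auto
  qed auto
  finally show ?thesis .
qed

text \<open>Exchanging sums, the total of a linear form over the binary set is the form evaluated at
  the sum of the set.\<close>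

lemma sum_prod_ramanujan_sum_mod_4:
  obtains l :: int where "(\<Sum>d\<in>D. \<Prod>i<r. ramanujan_sum (2 ^ n i) (d i) (x i)) = of_int l"
    and "l mod 4 = (int (card (binary_set r n D))
      + (if (\<Sum>i<r. \<Sum>j<n i. rev_digit (n i) (x i) j * (\<Sum>c\<in>binary_set r n D. c i j)) = 0 then 0 else 2)) mod 4"
proof
  let ?f = "\<lambda>c. \<Sum>i<r. \<Sum>j<n i. rev_digit (n i) (x i) j * c i j"
  have "sum ?f (binary_set r n D)
      = (\<Sum>i<r. \<Sum>j<n i. rev_digit (n i) (x i) j * (\<Sum>c\<in>binary_set r n D. c i j))"
    unfolding sum_distrib_left
    by (subst sum.swap, rule sum.cong[OF refl], rule sum.swap)
  then show "(\<Sum>c\<in>binary_set r n D. bit_sign (?f c)) mod 4 = (int (card (binary_set r n D))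
      + (if (\<Sum>i<r. \<Sum>j<n i. rev_digit (n i) (x i) j * (\<Sum>c\<in>binary_set r n D. c i j)) = 0 then 0 else 2)) mod 4"
    using sum_bit_sign_mod_4[of ?f "binary_set r n D"] by simp
qed (rule sum_prod_ramanujan_sum)

end

section \<open>Eigenvalues of gcd-graphs\<close>

text \<open>A product of cyclic groups is its own dual, so the index \<open>x\<close> of a character
  has the same type as its argument \<open>y\<close>.\<close>

definition product_char :: "'i set \<Rightarrow> ('i \<Rightarrow> nat) \<Rightarrow> ('i \<Rightarrow> int) \<Rightarrow> ('i \<Rightarrow> int) \<Rightarrow> complex" where
  "product_char I M x y = (\<Prod>i\<in>I. unit_root (M i) (x i * y i))"

lemma norm_product_char: "cmod (product_char I M x a) = 1"
  by (simp add: product_char_def flip: prod_norm)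

context
  fixes I :: "'i set" and M :: "'i \<Rightarrow> nat" and G
  assumes fin: "finite I" and pos: "\<forall>i\<in>I. M i > 0"
  defines "G \<equiv> product_group I (\<lambda>i. integer_mod_group (M i))"
begin

lemma carrier_product_mod: "carrier G = (\<Pi>\<^sub>E i\<in>I. {0..<int (M i)})"
  unfolding G_def carrier_product_group
  using pos by (intro PiE_cong) (force simp: carrier_integer_mod_group)

lemma product_char_mult:
  assumes "a \<in> carrier G" "b \<in> carrier G"
  shows "product_char I M x (a \<otimes>\<^bsub>G\<^esub> b) = product_char I M x a * product_char I M x b"
proof -
  have "unit_root (M i) (x i * ((a i + b i) mod int (M i)))
      = unit_root (M i) (x i * a i) * unit_root (M i) (x i * b i)" if "i \<in> I" for i
    unfolding unit_root_add[symmetric] distrib_left[symmetric]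
    by (rule unit_root_cong[OF pos[rule_format, OF that]]) (simp add: mod_mult_right_eq)
  then show ?thesis
    by (simp add: product_char_def G_def flip: prod.distrib)
qed

text \<open>The sum runs over the character index and splits into geometric sums. Representatives in
  the range of residues are congruent only if equal.\<close>

lemma product_char_orthogonal:
  assumes a: "a \<in> carrier G" and b: "b \<in> carrier G"
  shows "(\<Sum>x\<in>carrier G. cnj (product_char I M x a) * product_char I M x b)
    = (if a = b then of_nat (\<Prod>i\<in>I. M i) else 0)"
proof -
  have "(\<Sum>x\<in>carrier G. cnj (product_char I M x a) * product_char I M x b)
      = (\<Sum>x\<in>carrier G. \<Prod>i\<in>I. unit_root (M i) ((b i - a i) * x i))"
    by (simp add: product_char_def cnj_unit_root algebra_simps flip: prod.distrib unit_root_add)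
  also have "\<dots> = (\<Prod>i\<in>I. \<Sum>t\<in>{0..<int (M i)}. unit_root (M i) ((b i - a i) * t))"
    unfolding carrier_product_mod using fin by (subst prod_sum_PiE) auto
  also have "\<dots> = (\<Prod>i\<in>I. if int (M i) dvd b i - a i then of_nat (M i) else 0)"
    using pos by (simp add: sum_unit_root)
  also have "\<dots> = (\<Prod>i\<in>I. if a i = b i then of_nat (M i) else 0)"
  proof (rule prod.cong[OF refl])
    fix i assume "i \<in> I"
    then have "a i \<in> {0..<int (M i)}" "b i \<in> {0..<int (M i)}"
      using a b unfolding carrier_product_mod by (meson PiE_mem)+
    then have "int (M i) dvd b i - a i \<longleftrightarrow> a i = b i"
      by (auto simp flip: mod_eq_dvd_iff)
    then show "(if int (M i) dvd b i - a i then of_nat (M i) else (0 :: complex))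
        = (if a i = b i then of_nat (M i) else 0)" by simp
  qed
  also have "\<dots> = (if a = b then of_nat (\<Prod>i\<in>I. M i) else 0)"
  proof (cases "a = b")
    case False
    then obtain i where "i \<in> I" "a i \<noteq> b i"
      using a b unfolding carrier_product_mod by (meson PiE_ext)
    then have "(\<Prod>i\<in>I. if a i = b i then of_nat (M i) else (0 :: complex)) = 0"
      using fin by (intro prod_zero) auto
    then show ?thesis using False by simp
  qed simp
  finally show ?thesis .
qed

end

lemma prod_lessThan_add:
  fixes f :: "nat \<Rightarrow> 'a :: comm_monoid_mult"
  shows "(\<Prod>i<r + s. f i) = (\<Prod>i<r. f i) * (\<Prod>j<s. f (r + j))"
  by (induction s) (simp_all add: mult.assoc)

text \<open>The exponential is the power i^l of the imaginary unit, which has period 4 in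
  \<open>l\<close>.\<close>

lemma exp_quarter_cong:
  fixes l k :: int
  assumes "l mod 4 = k mod 4"
  shows "exp (\<i> * of_real (pi / 2) * of_int l) = exp (\<i> * of_real (pi / 2) * of_int k)"
proof -
  obtain q where q: "l = k + 4 * q"
    using assms by (metis mod_eq_dvd_iff dvd_def diff_add_cancel add.commute)
  have "exp (\<i> * of_real (pi / 2) * of_int (4 * q)) = cis (2 * pi * of_int q)"
    by (simp add: cis_conv_exp algebra_simps)
  then show ?thesis by (simp add: q distrib_left exp_add)
qed

lemma exp_quarter_add_2:
  fixes k :: int
  shows "exp (\<i> * of_real (pi / 2) * of_int (k + 2)) = - exp (\<i> * of_real (pi / 2) * of_int k)"
proof -
  have "exp (\<i> * of_real (pi / 2) * 2) = - 1"
    using cis_pi by (simp add: cis_conv_exp)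
  then show ?thesis by (simp add: distrib_left exp_add)
qed

lemma norm_exp_quarter: "cmod (exp (\<i> * of_real (pi / 2) * of_int k)) = 1"
  using norm_cis[of "pi / 2 * of_int k"] by (simp add: cis_conv_exp mult.assoc)

definition gcd_eigenvalue :: "nat \<Rightarrow> (nat \<Rightarrow> nat) \<Rightarrow> (nat \<Rightarrow> nat) set \<Rightarrow> (nat \<Rightarrow> int) \<Rightarrow> complex" where
  "gcd_eigenvalue K M D x = (\<Sum>d\<in>D. \<Prod>i<K. ramanujan_sum (M i) (d i) (x i))"

lemma divisor_tuples_dvd_2_power:
  assumes "d \<in> divisor_tuples r s n p m" "i < r"
  shows "d i dvd 2 ^ n i"
  using PiE_mem[OF assms(1)[unfolded divisor_tuples_def], of i] assms(2)
  by (simp add: modulus_tuple_def)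

lemma divisor_tuples_dvd_prime_power:
  assumes "d \<in> divisor_tuples r s n p m" "j < s"
  shows "d (r + j) dvd p j ^ m j"
  using PiE_mem[OF assms(1)[unfolded divisor_tuples_def], of "r + j"] assms(2)
  by (simp add: modulus_tuple_def)

lemma divisor_tuples_eqI:
  assumes "d \<in> divisor_tuples r s n p m" "e \<in> divisor_tuples r s n p m"
    and "\<And>i. i < r \<Longrightarrow> d i = e i" "\<And>j. j < s \<Longrightarrow> d (r + j) = e (r + j)"
  shows "d = e"
proof (rule PiE_ext)
  show "d i = e i" if "i \<in> {..<r + s}" for i
    using assms(3)[of i] assms(4)[of "i - r"] that by (cases "i < r") auto
qed (use assms in \<open>auto simp: divisor_tuples_def\<close>)

section \<open>Phases of the eigenvalues at time pi/2\<close>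

context
  fixes r s :: nat and n p m :: "nat \<Rightarrow> nat"
  assumes primes: "\<forall>j<s. prime (p j)"
begin

lemma modulus_tuple_pos: "i < r + s \<Longrightarrow> modulus_tuple r s n p m i > 0"
  using primes prime_gt_0_nat by (auto simp: modulus_tuple_def)

lemma finite_divisor_tuples: "finite (divisor_tuples r s n p m)"
  unfolding divisor_tuples_def using modulus_tuple_pos
  by (intro finite_PiE) (auto intro!: finite_divisors_nat)

text \<open>The gcd-set is a union of boxes, one for each tuple. They are disjoint because
  \<open>d\<close> is recovered from \<open>y\<close> by taking gcds; each box sum factors into
  Ramanujan sums.\<close>

lemma sum_product_char_gcd_set:
  assumes "D \<subseteq> divisor_tuples r s n p m"
  shows "(\<Sum>y\<in>gcd_set r s n p m D. product_char {..<r + s} (modulus_tuple r s n p m) x y)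
    = gcd_eigenvalue (r + s) (modulus_tuple r s n p m) D x"
proof -
  let ?M = "modulus_tuple r s n p m"
  let ?S = "\<lambda>d. \<Pi>\<^sub>E i\<in>{..<r + s}. {y. y \<in> {0..<int (?M i)} \<and> gcd y (int (?M i)) = int (d i)}"
  have carrier: "carrier (Gam r s n p m) = (\<Pi>\<^sub>E i\<in>{..<r + s}. {0..<int (?M i)})"
    unfolding Gam_def using modulus_tuple_pos by (intro carrier_product_mod) auto
  have fin_factor: "finite {y. y \<in> {0..<int N} \<and> gcd y (int N) = int k}" for N k
    by (rule rev_finite_subset[OF finite_atLeastLessThan_int]) blast
  then have fin: "finite (?S d)" for d by (intro finite_PiE finite_lessThan)
  have "gcd_set r s n p m D = (\<Union>d\<in>D. ?S d)"
    unfolding gcd_set_def carrier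
    by (rule SUP_cong[OF refl]) (simp only: set_eq_iff mem_Collect_eq PiE_iff lessThan_iff, blast)
  moreover have "(\<Sum>y\<in>(\<Union>d\<in>D. ?S d). product_char {..<r + s} ?M x y)
      = (\<Sum>d\<in>D. \<Sum>y\<in>?S d. product_char {..<r + s} ?M x y)"
  proof (rule sum.UNION_disjoint)
    show "finite D" using assms finite_divisor_tuples finite_subset by blast
    show "\<forall>d\<in>D. \<forall>e\<in>D. d \<noteq> e \<longrightarrow> ?S d \<inter> ?S e = {}"
    proof (intro ballI impI, rule ccontr)
      fix d e assume de: "d \<in> D" "e \<in> D" "d \<noteq> e" and "?S d \<inter> ?S e \<noteq> {}"
      then obtain y where y: "y \<in> ?S d" "y \<in> ?S e" by blast
      have "d i = e i" if "i < r + s" for i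
        using PiE_mem[OF y(1), of i] PiE_mem[OF y(2), of i] that by simp
      moreover have "d \<in> divisor_tuples r s n p m" "e \<in> divisor_tuples r s n p m"
        using de assms by auto
      ultimately show False
        using de(3) unfolding divisor_tuples_def by (metis PiE_ext lessThan_iff)
    qed
  qed (use fin in blast)
  moreover have "(\<Sum>y\<in>?S d. product_char {..<r + s} ?M x y)
      = (\<Prod>i<r + s. ramanujan_sum (?M i) (d i) (x i))" for d
    unfolding product_char_def ramanujan_sum_def
    by (rule prod_sum_PiE[symmetric]) (rule finite_lessThan fin_factor)+
  ultimately show ?thesis by (simp add: gcd_eigenvalue_def)
qed

text \<open>The odd part, shared with the representative \<open>d0\<close>, factors out as an
  integer \<open>q\<close>, while the 2-parts give \<open>l\<close>. If the odd components are the
  full moduli, every Ramanujan sum in \<open>q\<close> is 1.\<close>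

lemma gcd_eigenvalue_mod_4:
  assumes sub: "D \<subseteq> divisor_tuples r s n p m"
    and same: "\<forall>d\<in>D. \<forall>j<s. d (r + j) = d0 (r + j)"
    and d0: "d0 \<in> D"
  obtains l q :: int where
    "gcd_eigenvalue (r + s) (modulus_tuple r s n p m) D x = of_int (l * q)"
    and "l mod 4 = (int (card (binary_set r n D)) + (if (\<Sum>i<r. \<Sum>j<n i.
        rev_digit (n i) (x i) j * (\<Sum>c\<in>binary_set r n D. c i j)) = 0 then 0 else 2)) mod 4"
    and "(\<And>j. j < s \<Longrightarrow> d0 (r + j) = p j ^ m j) \<Longrightarrow> q = 1"
proof -
  let ?M = "modulus_tuple r s n p m"
  let ?Q = "\<Prod>j<s. ramanujan_sum (p j ^ m j) (d0 (r + j)) (x (r + j))"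
  have fin: "finite D" using sub finite_divisor_tuples finite_subset by blast
  have dvd: "\<forall>d\<in>D. \<forall>i<r. d i dvd 2 ^ n i"
    using divisor_tuples_dvd_2_power[of _ r s n p m] sub by blast
  have sep: "\<forall>d\<in>D. \<forall>e\<in>D. (\<forall>i<r. d i = e i) \<longrightarrow> d = e"
  proof (intro ballI impI)
    fix d e assume de: "d \<in> D" "e \<in> D" "\<forall>i<r. d i = e i"
    show "d = e"
    proof (rule divisor_tuples_eqI[of d r s n p m e])
      fix j assume "j < s"
      then have "d (r + j) = d0 (r + j)" "e (r + j) = d0 (r + j)" using same de by blast+
      then show "d (r + j) = e (r + j)" by (simp only:)
    qed (use sub de in blast)+
  qed
  have "gcd_eigenvalue (r + s) ?M D x
      = (\<Sum>d\<in>D. (\<Prod>i<r. ramanujan_sum (2 ^ n i) (d i) (x i)) * ?Q)"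
    unfolding gcd_eigenvalue_def
    by (rule sum.cong) (simp_all add: prod_lessThan_add modulus_tuple_def same)
  also have "\<dots> = (\<Sum>d\<in>D. \<Prod>i<r. ramanujan_sum (2 ^ n i) (d i) (x i)) * ?Q"
    by (rule sum_distrib_right[symmetric])
  finally have eq: "gcd_eigenvalue (r + s) ?M D x
      = (\<Sum>d\<in>D. \<Prod>i<r. ramanujan_sum (2 ^ n i) (d i) (x i)) * ?Q" .
  have "d0 (r + j) dvd p j ^ m j" if "j < s" for j
    using divisor_tuples_dvd_prime_power[of d0 r s n p m] d0 sub that by blast
  then have "?Q \<in> \<int>" by (auto intro!: Ints_prod ramanujan_sum_prime_power_in_Ints simp: primes)
  then obtain q :: int where q: "?Q = of_int q" by (auto elim: Ints_cases)
  have q1: "q = 1" if "\<And>j. j < s \<Longrightarrow> d0 (r + j) = p j ^ m j"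
  proof -
    have "?Q = 1"
      using that primes prime_gt_0_nat by (intro prod.neutral) (simp add: ramanujan_sum_self)
    then show ?thesis using q by simp
  qed
  obtain l where "(\<Sum>d\<in>D. \<Prod>i<r. ramanujan_sum (2 ^ n i) (d i) (x i)) = of_int l"
    and "l mod 4 = (int (card (binary_set r n D)) + (if (\<Sum>i<r. \<Sum>j<n i.
        rev_digit (n i) (x i) j * (\<Sum>c\<in>binary_set r n D. c i j)) = 0 then 0 else 2)) mod 4"
    using sum_prod_ramanujan_sum_mod_4[OF fin dvd sep] by blast
  with eq q q1 show thesis by (intro that[of l q]) simp_all
qed

text \<open>The zero sum removes the dependence of \<open>l\<close> on \<open>x\<close> modulo 4,
  and the cardinality condition neutralises \<open>q\<close> whenever \<open>q\<close> may differ
  from 1. The phase is i to the power of the cardinality of the binary set.\<close>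

lemma exp_gcd_eigenvalue_script_D':
  assumes "D \<in> script_D' r s n p m"
  shows "\<exists>\<kappa>. cmod \<kappa> = 1 \<and>
    (\<forall>x. exp (\<i> * of_real (pi / 2) * gcd_eigenvalue (r + s) (modulus_tuple r s n p m) D x) = \<kappa>)"
proof (cases "D = {}")
  case True
  then show ?thesis by (auto simp: gcd_eigenvalue_def)
next
  case False
  then obtain d0 where d0: "d0 \<in> D" by auto
  from assms have sub: "D \<subseteq> divisor_tuples r s n p m"
    and same: "\<forall>d\<in>D. \<forall>j<s. d (r + j) = d0 (r + j)"
    and zero: "zero_sum r n (binary_set r n D)"
    and card: "\<And>j. j < s \<Longrightarrow> d0 (r + j) < p j ^ m j \<Longrightarrow> card (binary_set r n D) mod 4 = 0"
    using d0 unfolding script_D'_def by blast+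
  have S: "(\<Sum>i<r. \<Sum>j<n i. rev_digit (n i) (x i) j * (\<Sum>c\<in>binary_set r n D. c i j)) = 0" for x
    using zero by (simp add: zero_sum_def)
  show ?thesis
  proof (intro exI conjI allI)
    let ?c = "int (card (binary_set r n D))"
    show "cmod (exp (\<i> * of_real (pi / 2) * of_int ?c)) = 1" by (rule norm_exp_quarter)
    fix x
    obtain l q :: int where lq: "gcd_eigenvalue (r + s) (modulus_tuple r s n p m) D x = of_int (l * q)"
      "l mod 4 = ?c mod 4" "(\<And>j. j < s \<Longrightarrow> d0 (r + j) = p j ^ m j) \<Longrightarrow> q = 1"
      using gcd_eigenvalue_mod_4[OF sub same d0, of x] unfolding S by auto
    \<comment> \<open>If some odd component is proper, both sides are 0 modulo 4 for any
      \<open>q\<close>; otherwise \<open>q = 1\<close>.\<close>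
    have "(l * q) mod 4 = ?c mod 4"
    proof (cases "\<exists>j<s. d0 (r + j) < p j ^ m j")
      case True
      then have "?c mod 4 = 0" using card by (metis of_nat_0 of_nat_mod of_nat_numeral)
      then show ?thesis using lq(2) by (metis mod_mult_left_eq mult_zero_left mod_0)
    next
      case False
      have "d0 (r + j) = p j ^ m j" if "j < s" for j
      proof -
        have "d0 (r + j) dvd p j ^ m j"
          using divisor_tuples_dvd_prime_power[of d0 r s n p m] d0 sub that by blast
        then have "d0 (r + j) \<le> p j ^ m j"
          using primes that prime_gt_0_nat by (intro dvd_imp_le) auto
        then show ?thesis using False that by (meson le_neq_implies_less)
      qed
      then show ?thesis using lq by simp
    qed
    then show "exp (\<i> * of_real (pi / 2) * gcd_eigenvalue (r + s) (modulus_tuple r s n p m) D x)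
        = exp (\<i> * of_real (pi / 2) * of_int ?c)"
      unfolding lq(1) by (rule exp_quarter_cong)
  qed
qed

text \<open>Eigenvalues add over a disjoint union, so the constant phases of the members
  multiply.\<close>

lemma exp_gcd_eigenvalue_script_D:
  assumes "D \<in> script_D r s n p m"
  shows "\<exists>\<kappa>. cmod \<kappa> = 1 \<and>
    (\<forall>x. exp (\<i> * of_real (pi / 2) * gcd_eigenvalue (r + s) (modulus_tuple r s n p m) D x) = \<kappa>)"
proof -
  obtain F where F: "D = \<Union>F" "F \<subseteq> script_D' r s n p m" "disjoint F"
    using assms unfolding script_D_def by blast
  then have sub: "E \<subseteq> divisor_tuples r s n p m" if "E \<in> F" for E
    using that unfolding script_D'_def by blast
  \<comment> \<open>The alternative \<open>E = {}\<close> makes finiteness of \<open>F\<close>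
    available even without a member of \<open>F\<close> at hand.\<close>
  have fin: "finite F" "finite E" if "E \<in> F \<or> E = {}" for E
    using sub finite_divisor_tuples that
    by (auto intro: finite_subset[of F "Pow (divisor_tuples r s n p m)"] finite_subset)
  obtain \<kappa> where \<kappa>: "cmod (\<kappa> E) = 1"
    "exp (\<i> * of_real (pi / 2) * gcd_eigenvalue (r + s) (modulus_tuple r s n p m) E x) = \<kappa> E"
    if "E \<in> F" for E x
    using exp_gcd_eigenvalue_script_D' F(2) by (metis subsetD)
  have "gcd_eigenvalue (r + s) (modulus_tuple r s n p m) D x
      = (\<Sum>E\<in>F. gcd_eigenvalue (r + s) (modulus_tuple r s n p m) E x)" for x
    unfolding gcd_eigenvalue_def F(1)
    using F(3) fin by (subst sum.Union_disjoint) (auto simp: disjoint_def)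
  then have "exp (\<i> * of_real (pi / 2) * gcd_eigenvalue (r + s) (modulus_tuple r s n p m) D x)
      = (\<Prod>E\<in>F. \<kappa> E)" for x
    using \<kappa> fin(1)[of "{}"] by (simp add: sum_distrib_left exp_sum)
  moreover have "cmod (\<Prod>E\<in>F. \<kappa> E) = 1"
    using \<kappa> by (simp add: prod.neutral flip: prod_norm)
  ultimately show ?thesis by blast
qed

text \<open>Only the last coordinate of each block can contribute to the sum of the binary set, so
  that sum is the binary expansion of an element \<open>z\<close> of order two.\<close>

lemma exp_gcd_eigenvalue_script_D_tilde:
  assumes "D \<in> script_D_tilde r s n p m"
  obtains \<kappa> z where "cmod \<kappa> = 1" "z \<in> carrier (Gam r s n p m)" "z \<noteq> \<one>\<^bsub>Gam r s n p m\<^esub>"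
    "\<And>x. exp (\<i> * of_real (pi / 2) * gcd_eigenvalue (r + s) (modulus_tuple r s n p m) D x)
      = \<kappa> * product_char {..<r + s} (modulus_tuple r s n p m) x z"
proof -
  let ?M = "modulus_tuple r s n p m"
  from assms have sub: "D \<subseteq> divisor_tuples r s n p m"
    and last: "\<And>d j. d \<in> D \<Longrightarrow> j < s \<Longrightarrow> d (r + j) = p j ^ m j"
    and nonzero: "\<not> zero_sum r n (binary_set r n D)"
    unfolding script_D_tilde_def by blast+
  define \<sigma> where "\<sigma> = (\<lambda>i j. \<Sum>c\<in>binary_set r n D. c i j)"
  \<comment> \<open>\<open>2 ^ (n i - 1)\<close> is the element of order two in its component; the
    guard \<open>n i > 0\<close> excludes trivial components, which have none.\<close>
  define z where "z = (\<lambda>i\<in>{..<r + s}.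
    if i < r \<and> n i > 0 \<and> \<sigma> i (n i - 1) = 1 then 2 ^ (n i - 1) else (0 :: int))"
  have fin: "finite D" using sub finite_divisor_tuples finite_subset by blast
  have dvd: "\<forall>d\<in>D. \<forall>i<r. d i dvd 2 ^ n i"
    using divisor_tuples_dvd_2_power[of _ r s n p m] sub by blast
  have sep: "\<forall>d\<in>D. \<forall>e\<in>D. (\<forall>i<r. d i = e i) \<longrightarrow> d = e"
    using sub last by (metis divisor_tuples_eqI[of _ r s n p m] subsetD)
  have \<sigma>0: "\<sigma> i j = 0" if "i < r" "Suc j < n i" for i j
    unfolding \<sigma>_def using sum_binary_set_coordinate[OF fin dvd sep] that by blast
  obtain i0 j0 where ij: "i0 < r" "j0 < n i0" "\<sigma> i0 j0 \<noteq> 0"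
    using nonzero unfolding zero_sum_def \<sigma>_def by blast
  \<comment> \<open>By \<open>\<sigma>0\<close> a nonzero coordinate of the sum must be the last one
    of its block, so \<open>z\<close> is nontrivial at \<open>i0\<close>.\<close>
  then have j0: "n i0 - 1 = j0" "\<sigma> i0 j0 = 1" using \<sigma>0[of i0 j0] by fastforce+
  \<comment> \<open>\<open>D\<close> is nonempty, since an empty binary set has sum zero.\<close>
  obtain d0 where d0: "d0 \<in> D"
    using ij unfolding \<sigma>_def binary_set_def by fastforce
  have same: "\<forall>d\<in>D. \<forall>j<s. d (r + j) = d0 (r + j)"
  proof (intro ballI allI impI)
    fix d j assume "d \<in> D" "j < s"
    from last[OF this] last[OF d0 this(2)] show "d (r + j) = d0 (r + j)" by (simp only:)
  qed
  \<comment> \<open>In each block only the last coordinate survives. Its reversed digit is the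
    parity of \<open>x i\<close>, which is also what the character sees at
    \<open>2 ^ (n i - 1)\<close>.\<close>
  have char: "product_char {..<r + s} ?M x z
      = of_int (bit_sign (\<Sum>i<r. \<Sum>j<n i. rev_digit (n i) (x i) j * \<sigma> i j))" for x
  proof -
    have "unit_root (?M i) (x i * z i) = of_int (bit_sign (\<Sum>j<n i. rev_digit (n i) (x i) j * \<sigma> i j))"
      if i: "i < r" for i
    proof (cases "n i")
      case 0
      then show ?thesis using i by (simp add: z_def unit_root_def)
    next
      case (Suc k)
      have "(\<Sum>j<n i. rev_digit (n i) (x i) j * \<sigma> i j) = of_bool (odd (x i)) * \<sigma> i k"
        using \<sigma>0[OF i] by (simp add: Suc rev_digit_def)
      moreover have "unit_root (2 ^ n i) (x i * 2 ^ k) = (if even (x i) then 1 else - 1)"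
      proof -
        have "unit_root (2 ^ n i) (x i * 2 ^ k) = unit_root 2 (x i)"
          using unit_root_mult_cancel[of "2 ^ k" 2 "x i"] by (simp add: Suc mult.commute)
        also have "\<dots> = (if even (x i) then 1 else - 1)"
        proof (cases "even (x i)")
          case False
          then obtain y where "x i = 2 * y + 1" by (elim oddE)
          then have "unit_root 2 (x i) = unit_root 2 (2 * y) * unit_root 2 1"
            by (simp only: unit_root_add)
          also have "unit_root 2 (2 * y) = 1" by (simp add: unit_root_eq_1_iff)
          also have "unit_root 2 1 = - 1" by (simp add: unit_root_def)
          finally show ?thesis using False by simp
        qed (simp add: unit_root_eq_1_iff)
        finally show ?thesis .
      qed
      ultimately show ?thesis
        using i Suc by (cases "\<sigma> i k") (auto simp: z_def modulus_tuple_def unit_root_def[of _ 0])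
    qed
    moreover have "z (r + j) = 0" if "j < s" for j using that by (simp add: z_def)
    ultimately show ?thesis
      unfolding product_char_def prod_lessThan_add bit_sign_sum[of _ "{..<r}"]
      by (simp add: unit_root_def[of _ 0])
  qed
  show thesis
  proof
    let ?c = "int (card (binary_set r n D))"
    show "cmod (exp (\<i> * of_real (pi / 2) * of_int ?c)) = 1" by (rule norm_exp_quarter)
    have "2 ^ (n i - 1) < (2 :: int) ^ n i" if "n i > 0" for i using that by simp
    then show "z \<in> carrier (Gam r s n p m)"
      using modulus_tuple_pos
      by (auto simp: Gam_def carrier_product_mod z_def modulus_tuple_def carrier_integer_mod_group)
    have "z i0 \<noteq> 0" using ij j0 by (simp add: z_def)
    then show "z \<noteq> \<one>\<^bsub>Gam r s n p m\<^esub>" using ij(1) by (auto simp: Gam_def)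
    fix x
    let ?S = "\<Sum>i<r. \<Sum>j<n i. rev_digit (n i) (x i) j * \<sigma> i j"
    obtain l q :: int where lq: "gcd_eigenvalue (r + s) ?M D x = of_int (l * q)"
      "l mod 4 = (?c + (if ?S = 0 then 0 else 2)) mod 4" "(\<And>j. j < s \<Longrightarrow> d0 (r + j) = p j ^ m j) \<Longrightarrow> q = 1"
      using gcd_eigenvalue_mod_4[OF sub same d0, of x] unfolding \<sigma>_def by blast
    have "q = 1" by (rule lq(3)[OF last[OF d0]])
    then have "gcd_eigenvalue (r + s) ?M D x = of_int l" using lq(1) by simp
    then have "exp (\<i> * of_real (pi / 2) * gcd_eigenvalue (r + s) ?M D x)
        = exp (\<i> * of_real (pi / 2) * of_int (?c + (if ?S = 0 then 0 else 2)))"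
      using exp_quarter_cong[OF lq(2)] by simp
    \<comment> \<open>A shift of the exponent by 2 is multiplication by -1, the sign of the bit
      \<open>?S\<close>.\<close>
    also have "\<dots> = exp (\<i> * of_real (pi / 2) * of_int ?c) * of_int (bit_sign ?S)"
      using exp_quarter_add_2[of ?c] by (cases ?S) simp_all
    finally show "exp (\<i> * of_real (pi / 2) * gcd_eigenvalue (r + s) ?M D x)
        = exp (\<i> * of_real (pi / 2) * of_int ?c) * product_char {..<r + s} ?M x z"
      by (simp add: char)
  qed
qed

end

theorem theorem4p9:
  fixes r s :: nat and n p m :: "nat \<Rightarrow> nat" and D1 D2 D :: "(nat \<Rightarrow> nat) set"
  assumes "\<And>j. j < s \<Longrightarrow> prime (p j) \<and> p j > 2"
    and "D1 \<in> script_D r s n p m"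
    and "D2 \<in> script_D_tilde r s n p m"
    and "D1 \<inter> D2 = {}"
    and "D = D1 \<union> D2"
    and "generate (Gam r s n p m) (gcd_set r s n p m D) = carrier (Gam r s n p m)"
  shows "Digraph_Component.connected (with_proj (Cay (Gam r s n p m) (gcd_set r s n p m D))) \<and>
         admits_PST (Cay (Gam r s n p m) (gcd_set r s n p m D)) (pi / 2)"
proof
  let ?M = "modulus_tuple r s n p m" and ?G = "Gam r s n p m" and ?S = "gcd_set r s n p m D"
  have primes: "\<forall>j<s. prime (p j)" using assms(1) by blast
  have pos: "\<forall>i\<in>{..<r + s}. ?M i > 0" using modulus_tuple_pos[OF primes] by simp
  have G: "?G = product_group {..<r + s} (\<lambda>i. integer_mod_group (?M i))" by (simp add: Gam_def)
  interpret group ?G unfolding G by simp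
  have S: "?S \<subseteq> carrier ?G" unfolding gcd_set_def by blast
  show "Digraph_Component.connected (with_proj (Cay ?G ?S))"
    using S assms(6) by (rule connected_Cay)
  obtain \<kappa>1 where \<kappa>1: "cmod \<kappa>1 = 1"
    "\<And>x. exp (\<i> * of_real (pi / 2) * gcd_eigenvalue (r + s) ?M D1 x) = \<kappa>1"
    using exp_gcd_eigenvalue_script_D[OF primes assms(2)] by blast
  obtain \<kappa>2 z where \<kappa>2: "cmod \<kappa>2 = 1" and z: "z \<in> carrier ?G" "z \<noteq> \<one>\<^bsub>?G\<^esub>"
    and \<kappa>2z: "\<And>x. exp (\<i> * of_real (pi / 2) * gcd_eigenvalue (r + s) ?M D2 x)
      = \<kappa>2 * product_char {..<r + s} ?M x z"
    using exp_gcd_eigenvalue_script_D_tilde[OF primes assms(3)] by blast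
  have sub1: "D1 \<subseteq> divisor_tuples r s n p m"
    using assms(2) unfolding script_D_def script_D'_def by blast
  have sub2: "D2 \<subseteq> divisor_tuples r s n p m"
    using assms(3) unfolding script_D_tilde_def by blast
  have "finite D1" "finite D2"
    using finite_subset[OF sub1] finite_subset[OF sub2] finite_divisor_tuples[OF primes] by blast+
  \<comment> \<open>Disjointness of \<open>D1\<close> and \<open>D2\<close> makes the eigenvalues
    add: \<open>D1\<close> supplies only a constant phase, \<open>D2\<close> the character value at
    \<open>z\<close>.\<close>
  have eig: "(\<Sum>y\<in>?S. product_char {..<r + s} ?M x y)
      = gcd_eigenvalue (r + s) ?M D1 x + gcd_eigenvalue (r + s) ?M D2 x" for x
  proof -
    have "D \<subseteq> divisor_tuples r s n p m" using sub1 sub2 assms(5) by simp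
    from sum_product_char_gcd_set[OF primes this, of x] show ?thesis
      unfolding gcd_eigenvalue_def assms(5)
        sum.union_disjoint[OF \<open>finite D1\<close> \<open>finite D2\<close> assms(4)] .
  qed
  show "admits_PST (Cay ?G ?S) (pi / 2)"
  \<comment> \<open>The characters are indexed by the group itself, so \<open>X\<close> is the
    carrier and \<open>N\<close> the product of the moduli.\<close>
  proof (rule admits_PST_Cay[OF _ S])
    show "finite (carrier ?G)"
      unfolding G carrier_product_mod[OF finite_lessThan pos] by (intro finite_PiE) auto
    show "(\<Sum>x\<in>carrier ?G. cnj (product_char {..<r + s} ?M x a) * product_char {..<r + s} ?M x b)
        = (if a = b then of_nat (\<Prod>i<r + s. ?M i) else 0)"
      if "a \<in> carrier ?G" "b \<in> carrier ?G" for a b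
      using product_char_orthogonal[OF finite_lessThan pos, of a b] that unfolding G by blast
    show "of_nat (\<Prod>i<r + s. ?M i) \<noteq> (0 :: complex)" using pos by (auto simp: prod_zero_iff)
    show "product_char {..<r + s} ?M x (a \<otimes>\<^bsub>?G\<^esub> b)
        = product_char {..<r + s} ?M x a * product_char {..<r + s} ?M x b"
      if "a \<in> carrier ?G" "b \<in> carrier ?G" for x a b
      using product_char_mult[OF finite_lessThan pos, of a b x] that unfolding G by blast
    show "cmod (product_char {..<r + s} ?M x a) = 1" for x a
      by (rule norm_product_char)
    show "z \<in> carrier ?G" "z \<noteq> \<one>\<^bsub>?G\<^esub>" by fact+
    show "cmod (\<kappa>1 * \<kappa>2) = 1" using \<kappa>1 \<kappa>2 by (simp add: norm_mult)
    show "exp (\<i> * of_real (pi / 2) * (\<Sum>y\<in>?S. product_char {..<r + s} ?M x y))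
        = \<kappa>1 * \<kappa>2 * product_char {..<r + s} ?M x z" for x
      unfolding eig distrib_left exp_add \<kappa>1(2) \<kappa>2z by simp
  qed
qed

end
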